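(* Let $X=\{x_0,x_1,\ldots,x_m\}$ and let $c\in\mathbb{R}\langle\langle X\rangle\rangle$ be a rational series with linear representation $(\mu,\gamma,\lambda)$. Then for any integer $N_f>0$, the input-output map $\hat y=\hat F_c[\hat u]$ has a finite dimensional rational input and state affine realization on $B_\infty^{m+1}[0,N_f](\hat R)$ provided $\hat R>0$ is sufficiently small.
   Context: $X^\ast$ is the set of all words over the alphabet $X$ of noncommuting letters, including the empty word $\emptyset$. $\mathbb{R}\langle\langle X\rangle\rangle$ is the set of formal power series, i.e. maps $c:X^\ast\to\mathbb{R}$, $\eta\mapsto(c,\eta)$, an $\mathbb{R}$-algebra under the catenation (Cauchy) product; $\mathbb{R}\langle X\rangle$ is the subalgebra of polynomials. Rational series: a subalgebra $S$ of $\mathbb{R}\langle\langle X\rangle\rangle$ is rationally closed if every $c\in S$ invertible in $\mathbb{R}\langle\langle X\rangle\rangle$ has $c^{-1}\in S$. A series is rational if it belongs to the smallest rationally closed subalgebra containing $\mathbb{R}\langle X\rangle$. A linear representation of $c$ is a triple $(\mu,\gamma,\lambda)$ with $\mu:X^\ast\to\mathbb{R}^{n\times n}$ a monoid morphism and $\gamma,\lambda^T\in\mathbb{R}^{n\times1}$ such that $(c,\eta)=\lambda\mu(\eta)\gamma$ for all $\eta\in X^\ast$. (By Schützenberger's theorem a series is rational if and only if it has a linear representation.) Inputs: $B_\infty^{m+1}[0,N_f](\hat R)$ is the set of finite sequences $\hat u=(\hat u(0),\ldots,\hat u(N_f))$ in $\mathbb{R}^{m+1}$, $\hat u(N)=[\hat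 u_0(N),\ldots,\hat u_m(N)]^T$, with $\max_{N}\max_{0\le i\le m}|\hat u_i(N)|\le\hat R$; it is assumed throughout that the component $\hat u_0$ is a constant sequence. Discrete-time Fliess operator: $\hat F_c[\hat u](N)=\sum_{\eta\in X^\ast}(c,\eta)S_\eta[\hat u](N)$, where $S_\emptyset[\hat u](N)=1$ and $S_{x_i\eta}[\hat u](N)=\sum_{k=1}^N\hat u_i(k)S_\eta[\hat u](k)$ (empty sums are $0$, so $\hat F_c[\hat u](0)=(c,\emptyset)$). Realization: a (finite dimensional) discrete-time state space realization is rational input and state affine if its transition map has the form $$\hat z_i(N+1)=\sum_{j=1}^n r_{ij}(\hat u(N+1))\,\hat z_j(N)+s_i(\hat u(N+1)),\quad i=1,\ldots,n,$$ where $\hat z(N)\in\mathbb{R}^n$, $r_{ij}$ and $s_i$ are rational functions of $\hat u=[\hat u_0,\ldots,\hat u_m]^T$, and the output map $h:\hat z\mapsto\hat y$ is linear. That $\hat y=\hat F_c[\hat u]$ has such a realization on a set of inputs means that there are fixed $n$, $r_{ij}$, $s_i$, $h$ and a fixed initial state $\hat z(0)$ such that, for every input in the set, the recursion is well defined (no denominator vanishes) and $\hat F_c[\hat u](N)=h(\hat z(N))$ for all $N=0,1,\ldots,N_f$. *)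

theory Defs
  imports
    "HOL-Analysis.Infinite_Sum"
    "HOL-Library.Poly_Mapping"
    "Jordan_Normal_Form.Matrix"
begin

text \<open>
  The alphabet \<open>X = {x\<^sub>0, \<dots>, x\<^sub>m}\<close> is a finite type \<open>'x\<close>, so that \<open>m + 1 = CARD('x)\<close> and
  \<open>'x list\<close> is the set of all words; the letter \<open>x\<^sub>0\<close> is passed as a parameter where it
  plays a role. A vector of \<open>\<real>\<^sup>m\<^sup>+\<^sup>1\<close> is a function \<open>'x \<Rightarrow> real\<close>.
\<close>

type_synonym 'x series = "'x list \<Rightarrow> real"

definition series_zero :: "'x series" where
  "series_zero = (\<lambda>w. 0)"

definition series_one :: "'x series" where
  "series_one = (\<lambda>w. if w = [] then 1 else 0)"

definition series_add :: "'x series \<Rightarrow> 'x series \<Rightarrow> 'x series" where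
  "series_add c d = (\<lambda>w. c w + d w)"

definition series_scale :: "real \<Rightarrow> 'x series \<Rightarrow> 'x series" where
  "series_scale a c = (\<lambda>w. a * c w)"

definition series_mult :: "'x series \<Rightarrow> 'x series \<Rightarrow> 'x series" where
  "series_mult c d = (\<lambda>w. \<Sum>k\<le>length w. c (take k w) * d (drop k w))"

definition series_inverse :: "'x series \<Rightarrow> 'x series \<Rightarrow> bool" where
  "series_inverse c d \<longleftrightarrow> series_mult c d = series_one \<and> series_mult d c = series_one"

definition polynomials :: "'x series set" where
  "polynomials = {c. finite {w. c w \<noteq> 0}}"

definition subalgebra :: "'x series set \<Rightarrow> bool" where
  "subalgebra S \<longleftrightarrow>
     series_zero \<in> S \<and> series_one \<in> S \<and>
     (\<forall>c\<in>S. \<forall>d\<in>S. series_add c d \<in> S \<and> series_mult c d \<in> S) \<and>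
     (\<forall>a. \<forall>c\<in>S. series_scale a c \<in> S)"

definition rationally_closed :: "'x series set \<Rightarrow> bool" where
  "rationally_closed S \<longleftrightarrow> subalgebra S \<and> (\<forall>c\<in>S. \<forall>d. series_inverse c d \<longrightarrow> d \<in> S)"

definition rational_series :: "'x series \<Rightarrow> bool" where
  "rational_series c \<longleftrightarrow> c \<in> \<Inter>{S. rationally_closed S \<and> polynomials \<subseteq> S}"

definition linear_representation ::
  "nat \<Rightarrow> ('x list \<Rightarrow> real mat) \<Rightarrow> real mat \<Rightarrow> real mat \<Rightarrow> 'x series \<Rightarrow> bool" where
  "linear_representation n \<mu> \<gamma> \<Lambda> c \<longleftrightarrow>
     (\<forall>w. \<mu> w \<in> carrier_mat n n) \<and>
     \<mu> [] = 1\<^sub>m n \<and> (\<forall>v w. \<mu> (v @ w) = \<mu> v * \<mu> w) \<and>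
     \<gamma> \<in> carrier_mat n 1 \<and> \<Lambda> \<in> carrier_mat 1 n \<and>
     (\<forall>w. c w = (\<Lambda> * \<mu> w * \<gamma>) $$ (0, 0))"

text \<open>
  An input sequence is a function on \<open>nat\<close>; only its values at times \<open>0, \<dots>, N\<^sub>f\<close> are ever
  used below.
\<close>

type_synonym 'x input = "nat \<Rightarrow> 'x \<Rightarrow> real"

definition admissible_inputs :: "'x \<Rightarrow> nat \<Rightarrow> real \<Rightarrow> 'x input set" where
  "admissible_inputs x0 Nf R =
     {u. (\<forall>N\<le>Nf. \<forall>x. \<bar>u N x\<bar> \<le> R) \<and> (\<forall>N\<le>Nf. u N x0 = u 0 x0)}"

primrec iterated_sum :: "'x list \<Rightarrow> 'x input \<Rightarrow> nat \<Rightarrow> real" where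
  "iterated_sum [] u N = 1"
| "iterated_sum (x # w) u N = (\<Sum>k=1..N. u k x * iterated_sum w u k)"

text \<open>
  The series over all words is understood as an unconditional (equivalently, absolutely
  convergent) sum. Since \<open>infsum\<close> is \<open>0\<close> for a divergent sum, convergence is a separate
  predicate, which is demanded wherever the operator is used.
\<close>

definition fliess_converges :: "'x series \<Rightarrow> 'x input \<Rightarrow> nat \<Rightarrow> bool" where
  "fliess_converges c u N \<longleftrightarrow> (\<lambda>w. c w * iterated_sum w u N) summable_on UNIV"

definition fliess :: "'x series \<Rightarrow> 'x input \<Rightarrow> nat \<Rightarrow> real" where
  "fliess c u N = (\<Sum>\<^sub>\<infinity>w\<in>UNIV. c w * iterated_sum w u N)"

text \<open>
  Real polynomials in commuting indeterminates indexed by \<open>'x\<close>: finitely supported maps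
  from exponent vectors to coefficients. A rational function is a fraction, i.e. a pair of
  a numerator and a nonzero denominator; it is defined at a point where the given
  denominator does not vanish.
\<close>

type_synonym 'x mpoly = "('x \<Rightarrow>\<^sub>0 nat) \<Rightarrow>\<^sub>0 real"

definition mpoly_eval :: "('x::finite) mpoly \<Rightarrow> ('x \<Rightarrow> real) \<Rightarrow> real" where
  "mpoly_eval p v =
     (\<Sum>e\<in>Poly_Mapping.keys p.
        Poly_Mapping.lookup p e * (\<Prod>x\<in>UNIV. v x ^ Poly_Mapping.lookup e x))"

type_synonym 'x ratfun = "'x mpoly \<times> 'x mpoly"

definition is_ratfun :: "'x ratfun \<Rightarrow> bool" where
  "is_ratfun f \<longleftrightarrow> snd f \<noteq> 0"

definition ratfun_defined_at :: "('x::finite) ratfun \<Rightarrow> ('x \<Rightarrow> real) \<Rightarrow> bool" where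
  "ratfun_defined_at f v \<longleftrightarrow> mpoly_eval (snd f) v \<noteq> 0"

definition ratfun_eval :: "('x::finite) ratfun \<Rightarrow> ('x \<Rightarrow> real) \<Rightarrow> real" where
  "ratfun_eval f v = mpoly_eval (fst f) v / mpoly_eval (snd f) v"

text \<open>State components are numbered \<open>0, \<dots>, n - 1\<close>.\<close>

primrec state ::
  "nat \<Rightarrow> (nat \<Rightarrow> nat \<Rightarrow> ('x::finite) ratfun) \<Rightarrow> (nat \<Rightarrow> 'x ratfun) \<Rightarrow> real vec \<Rightarrow>
   'x input \<Rightarrow> nat \<Rightarrow> real vec" where
  "state n r s z0 u 0 = z0"
| "state n r s z0 u (Suc N) =
     vec n (\<lambda>i. (\<Sum>j<n. ratfun_eval (r i j) (u (Suc N)) * state n r s z0 u N $ j)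
                + ratfun_eval (s i) (u (Suc N)))"

definition recursion_well_defined ::
  "nat \<Rightarrow> (nat \<Rightarrow> nat \<Rightarrow> ('x::finite) ratfun) \<Rightarrow> (nat \<Rightarrow> 'x ratfun) \<Rightarrow> nat \<Rightarrow>
   'x input \<Rightarrow> bool" where
  "recursion_well_defined n r s Nf u \<longleftrightarrow>
     (\<forall>N<Nf. \<forall>i<n. (\<forall>j<n. ratfun_defined_at (r i j) (u (Suc N))) \<and>
                   ratfun_defined_at (s i) (u (Suc N)))"

definition linear_output :: "nat \<Rightarrow> (real vec \<Rightarrow> real) \<Rightarrow> bool" where
  "linear_output n h \<longleftrightarrow>
     (\<forall>v\<in>carrier_vec n. \<forall>w\<in>carrier_vec n. h (v + w) = h v + h w) \<and>
     (\<forall>a. \<forall>v\<in>carrier_vec n. h (a \<cdot>\<^sub>v v) = a * h v)"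

definition has_rational_input_state_affine_realization ::
  "('x::finite) series \<Rightarrow> nat \<Rightarrow> 'x input set \<Rightarrow> bool" where
  "has_rational_input_state_affine_realization c Nf U \<longleftrightarrow>
     (\<exists>n r s h z0.
        (\<forall>i<n. (\<forall>j<n. is_ratfun (r i j)) \<and> is_ratfun (s i)) \<and>
        linear_output n h \<and> z0 \<in> carrier_vec n \<and>
        (\<forall>u\<in>U. recursion_well_defined n r s Nf u \<and>
               (\<forall>N\<le>Nf. fliess_converges c u N \<and>
                       fliess c u N = h (state n r s z0 u N))))"

end

theory Submission
  imports Defs "HOL-Library.Cardinality" "Jordan_Normal_Form.Determinant"
begin

text \<open>
  Write \<open>Z N = \<Sum>w. \<mu>(w) \<gamma> S_w(N)\<close>, so that the output is \<open>\<Lambda> Z N\<close>. Since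
  \<open>S_(xw)(N+1) - S_(xw)(N) = u_x(N+1) S_w(N+1)\<close>, summing over all words gives
  \<open>(I - \<Sum>x. u_x(N+1) \<mu>(x)) Z(N+1) = Z N\<close>. For small inputs the matrix on the left is
  strictly diagonally dominant, hence invertible, and by Cramer's rule the entries of its
  inverse are rational functions of the input. Convergence follows from the crude bound
  \<open>|S_w(N)| \<le> (N\<^sub>f R)^|w|\<close>, as there are only \<open>(m+1)^k\<close> words of length \<open>k\<close>.
\<close>

section \<open>Polynomial functions\<close>

text \<open>Extra exponents contribute zero coefficients. This lets polynomials with different
  supports be evaluated over one common index set.\<close>

lemma mpoly_eval_superset:
  assumes "finite K" "Poly_Mapping.keys p \<subseteq> K"
  shows "mpoly_eval p v =
    (\<Sum>e\<in>K. Poly_Mapping.lookup p e * (\<Prod>x\<in>UNIV. v x ^ Poly_Mapping.lookup e x))"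
  unfolding mpoly_eval_def using assms
  by (intro sum.mono_neutral_left) (auto simp: in_keys_iff)

lemma mpoly_eval_0 [simp]: "mpoly_eval 0 v = 0"
  by (simp add: mpoly_eval_def)

lemma mpoly_eval_add: "mpoly_eval (p + q) v = mpoly_eval p v + mpoly_eval q v"
proof -
  let ?K = "Poly_Mapping.keys p \<union> Poly_Mapping.keys q"
  have "Poly_Mapping.keys (p + q) \<subseteq> ?K"
    by (rule Poly_Mapping.keys_add)
  then show ?thesis
    by (simp add: mpoly_eval_superset[of ?K] lookup_add distrib_right sum.distrib)
qed

lemma mpoly_eval_sum: "mpoly_eval (\<Sum>i\<in>I. f i) v = (\<Sum>i\<in>I. mpoly_eval (f i) v)"
  by (induction I rule: infinite_finite_induct) (simp_all add: mpoly_eval_add)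

lemma mpoly_eval_single:
  "mpoly_eval (Poly_Mapping.single e a) v = a * (\<Prod>x\<in>UNIV. v x ^ Poly_Mapping.lookup e x)"
  by (subst mpoly_eval_superset[of "{e}"]) auto

text \<open>Decomposition into monomials. It reduces multiplicativity of evaluation to products of
  two monomials, where exponents simply add.\<close>

lemma poly_mapping_sum_single:
  "p = (\<Sum>e\<in>Poly_Mapping.keys p. Poly_Mapping.single e (Poly_Mapping.lookup p e))"
proof (rule poly_mapping_eqI)
  fix k
  have "(\<Sum>e\<in>Poly_Mapping.keys p. Poly_Mapping.lookup (Poly_Mapping.single e (Poly_Mapping.lookup p e)) k)
      = (\<Sum>e\<in>Poly_Mapping.keys p. if e = k then Poly_Mapping.lookup p e else 0)"
    by (intro sum.cong) (auto simp: lookup_single)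
  also have "\<dots> = Poly_Mapping.lookup p k"
    by (simp add: in_keys_iff)
  finally show "Poly_Mapping.lookup p k =
      Poly_Mapping.lookup (\<Sum>e\<in>Poly_Mapping.keys p. Poly_Mapping.single e (Poly_Mapping.lookup p e)) k"
    by (simp add: Poly_Mapping.lookup_sum)
qed

lemma mpoly_eval_mult: "mpoly_eval (p * q) v = mpoly_eval p v * mpoly_eval q v"
proof -
  have "p * q = (\<Sum>e\<in>Poly_Mapping.keys p. \<Sum>f\<in>Poly_Mapping.keys q.
      Poly_Mapping.single (e + f) (Poly_Mapping.lookup p e * Poly_Mapping.lookup q f))"
    by (subst poly_mapping_sum_single[of p], subst poly_mapping_sum_single[of q])
      (simp add: sum_product mult_single)
  then show ?thesis
    by (simp add: mpoly_eval_sum mpoly_eval_single lookup_add power_add prod.distrib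
        mpoly_eval_def[of p] mpoly_eval_def[of q] sum_product mult_ac)
qed

text \<open>Polynomiality is expressed on the level of functions, so that determinants and cofactors
  can be treated by closure rules; a representing polynomial is extracted only at the end.\<close>

definition mpoly_function :: "(('x::finite \<Rightarrow> real) \<Rightarrow> real) \<Rightarrow> bool" where
  "mpoly_function f \<longleftrightarrow> (\<exists>p. \<forall>v. mpoly_eval p v = f v)"

lemma mpoly_function_const: "mpoly_function (\<lambda>v. a)"
  unfolding mpoly_function_def
  by (rule exI[of _ "Poly_Mapping.single 0 a"]) (simp add: mpoly_eval_single)

lemma mpoly_function_coordinate: "mpoly_function (\<lambda>v. v x)"
proof -
  have "(\<Prod>y\<in>UNIV. v y ^ Poly_Mapping.lookup (Poly_Mapping.single x 1) y) = v x"
    for v :: "'a \<Rightarrow> real"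
    by (subst prod.remove[of _ x]) (auto simp: lookup_single intro!: prod.neutral)
  then show ?thesis
    unfolding mpoly_function_def
    by (intro exI[of _ "Poly_Mapping.single (Poly_Mapping.single x 1) 1"])
      (simp add: mpoly_eval_single)
qed

lemma mpoly_function_add:
  "mpoly_function f \<Longrightarrow> mpoly_function g \<Longrightarrow> mpoly_function (\<lambda>v. f v + g v)"
  unfolding mpoly_function_def by (metis mpoly_eval_add)

lemma mpoly_function_mult:
  "mpoly_function f \<Longrightarrow> mpoly_function g \<Longrightarrow> mpoly_function (\<lambda>v. f v * g v)"
  unfolding mpoly_function_def by (metis mpoly_eval_mult)

lemma mpoly_function_diff:
  assumes "mpoly_function f" "mpoly_function g"
  shows "mpoly_function (\<lambda>v. f v - g v)"
  using mpoly_function_add[OF assms(1) mpoly_function_mult[OF mpoly_function_const[of "-1"] assms(2)]]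
  by simp

lemma mpoly_function_sum:
  "(\<And>i. i \<in> I \<Longrightarrow> mpoly_function (f i)) \<Longrightarrow> mpoly_function (\<lambda>v. \<Sum>i\<in>I. f i v)"
  by (induction I rule: infinite_finite_induct)
    (auto intro: mpoly_function_const mpoly_function_add)

lemma mpoly_function_prod:
  "(\<And>i. i \<in> I \<Longrightarrow> mpoly_function (f i)) \<Longrightarrow> mpoly_function (\<lambda>v. \<Prod>i\<in>I. f i v)"
  by (induction I rule: infinite_finite_induct)
    (auto intro: mpoly_function_const mpoly_function_mult)

text \<open>The Leibniz formula writes the determinant as a finite sum of signed products of
  entries.\<close>

lemma mpoly_function_det:
  assumes "\<And>v. A v \<in> carrier_mat n n"
    and "\<And>i j. i < n \<Longrightarrow> j < n \<Longrightarrow> mpoly_function (\<lambda>v. A v $$ (i, j))"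
  shows "mpoly_function (\<lambda>v. det (A v))"
proof -
  have "mpoly_function (\<lambda>v. \<Sum>p | p permutes {0..<n}. signof p * (\<Prod>i = 0..<n. A v $$ (i, p i)))"
    using permutes_in_image
    by (fastforce intro!: mpoly_function_sum mpoly_function_mult mpoly_function_const
        mpoly_function_prod assms(2))
  then show ?thesis
    by (simp add: det_def'[OF assms(1)])
qed

text \<open>An entry of the adjugate is a signed minor with transposed indices, and the minor is
  again a determinant of entries of \<open>A v\<close>.\<close>

lemma mpoly_function_adj_mat:
  assumes A: "\<And>v. A v \<in> carrier_mat n n"
    and P: "\<And>i j. i < n \<Longrightarrow> j < n \<Longrightarrow> mpoly_function (\<lambda>v. A v $$ (i, j))"
    and ij: "i < n" "j < n"
  shows "mpoly_function (\<lambda>v. adj_mat (A v) $$ (i, j))"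
proof -
  obtain m where m: "n = Suc m"
    using ij by (cases n) auto
  have "mpoly_function (\<lambda>v. det (mat_delete (A v) j i))"
  proof (rule mpoly_function_det)
    show "mat_delete (A v) j i \<in> carrier_mat m m" for v
      using mat_delete_carrier[OF A, of v j i] m by simp
    fix k l assume kl: "k < m" "l < m"
    \<comment> \<open>\<open>insert_index\<close> skips the deleted row or column, so each entry of
      the minor is an entry of the full matrix.\<close>
    have "insert_index j k < n" "insert_index i l < n"
      using kl m by (auto simp: insert_index_def)
    from P[OF this] show "mpoly_function (\<lambda>v. mat_delete (A v) j i $$ (k, l))"
      using mat_delete_index[of "A _" m j i k l] A m ij kl by simp
  qed
  then have "mpoly_function (\<lambda>v. (-1) ^ (j + i) * det (mat_delete (A v) j i))"
    by (intro mpoly_function_mult mpoly_function_const)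
  moreover have "adj_mat (A v) $$ (i, j) = (-1) ^ (j + i) * det (mat_delete (A v) j i)" for v
    using A[of v] ij by (simp add: adj_mat_def cofactor_def)
  ultimately show ?thesis by simp
qed

section \<open>Perturbations of the identity matrix\<close>

text \<open>A nonzero kernel vector \<open>v\<close> would satisfy
  \<open>v $ i = (\<Sum>j<n. e i j * v $ j)\<close> in every row. In a row where
  \<open>\<bar>v $ i\<bar>\<close> attains its maximum \<open>M\<close>, the row-sum bound gives
  \<open>M < M\<close>.\<close>

lemma det_one_minus_nonzero:
  fixes e :: "nat \<Rightarrow> nat \<Rightarrow> real"
  assumes "\<And>i. i < n \<Longrightarrow> (\<Sum>j<n. \<bar>e i j\<bar>) < 1"
  shows "det (mat n n (\<lambda>(i, j). (if i = j then 1 else 0) - e i j)) \<noteq> 0" (is "det ?A \<noteq> 0")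
proof
  assume "det ?A = 0"
  then obtain v where v: "v \<in> carrier_vec n" "v \<noteq> 0\<^sub>v n" "?A *\<^sub>v v = 0\<^sub>v n"
    using det_0_iff_vec_prod_zero[of ?A n] by auto
  have n: "n > 0"
    using v(1,2) by (cases n) auto
  define M where "M = Max ((\<lambda>i. \<bar>v $ i\<bar>) ` {..<n})"
  have le: "\<bar>v $ i\<bar> \<le> M" if "i < n" for i
    using that by (auto simp: M_def)
  have "M \<in> (\<lambda>i. \<bar>v $ i\<bar>) ` {..<n}"
    using n by (auto simp: M_def intro!: Max_in)
  then obtain i where i: "i < n" "M = \<bar>v $ i\<bar>" by auto
  \<comment> \<open>A nonzero coordinate makes \<open>M\<close> positive, which the strict
    inequality at the end requires.\<close>
  obtain k where "k < n" "v $ k \<noteq> 0"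
    using v(1,2) by (metis carrier_vecD eq_vecI index_zero_vec(1) index_zero_vec(2))
  then have "M > 0" using le[of k] by linarith
  have "0 = (?A *\<^sub>v v) $ i" using v(3) i(1) by simp
  also have "\<dots> = (\<Sum>j<n. ((if i = j then 1 else 0) - e i j) * v $ j)"
    using i(1) v(1) by (simp add: scalar_prod_def lessThan_atLeast0)
  also have "\<dots> = (\<Sum>j<n. if i = j then v $ j else 0) - (\<Sum>j<n. e i j * v $ j)"
    unfolding sum_subtractf[symmetric] by (rule sum.cong) (auto simp: algebra_simps)
  also have "\<dots> = v $ i - (\<Sum>j<n. e i j * v $ j)"
    using i(1) by simp
  finally have "M = \<bar>\<Sum>j<n. e i j * v $ j\<bar>" using i(2) by simp
  also have "\<dots> \<le> (\<Sum>j<n. \<bar>e i j\<bar> * M)"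
    by (rule order_trans[OF sum_abs]) (auto simp: abs_mult intro!: sum_mono mult_left_mono le)
  also have "\<dots> = (\<Sum>j<n. \<bar>e i j\<bar>) * M" by (simp add: sum_distrib_right)
  also have "\<dots> < 1 * M"
    using assms[OF i(1)] \<open>M > 0\<close> by (rule mult_strict_right_mono)
  finally show False by simp
qed

section \<open>Iterated sums\<close>

lemma has_sum_sum:
  fixes f :: "'i \<Rightarrow> 'a \<Rightarrow> 'b::topological_comm_monoid_add"
  assumes "\<And>i. i \<in> I \<Longrightarrow> (f i has_sum s i) A"
  shows "((\<lambda>x. \<Sum>i\<in>I. f i x) has_sum (\<Sum>i\<in>I. s i)) A"
  using assms by (induction I rule: infinite_finite_induct) (auto intro: has_sum_add)

text \<open>Each letter adds one summation of at most \<open>Nf\<close> terms, each weighted by an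
  input value of size at most \<open>R\<close>.\<close>

lemma abs_iterated_sum_le:
  assumes u: "\<And>k x. k \<le> Nf \<Longrightarrow> \<bar>u k x\<bar> \<le> R" and "N \<le> Nf"
  shows "\<bar>iterated_sum w u N\<bar> \<le> (real Nf * R) ^ length w"
  using assms(2)
proof (induction w arbitrary: N)
  case (Cons x w)
  have R: "0 \<le> R" using u[of 0 x] by linarith
  have "\<bar>iterated_sum (x # w) u N\<bar> \<le> (\<Sum>k = 1..N. \<bar>u k x * iterated_sum w u k\<bar>)"
    by simp
  also have "\<dots> \<le> (\<Sum>k = 1..N. R * (real Nf * R) ^ length w)"
    unfolding abs_mult using Cons R by (intro sum_mono mult_mono u Cons.IH) auto
  also have "\<dots> \<le> real Nf * (R * (real Nf * R) ^ length w)"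
    using R Cons.prems by (simp add: mult_right_mono)
  finally show ?case by (simp add: mult_ac)
qed simp

text \<open>There are \<open>CARD('x) ^ k\<close> words of length \<open>k\<close>; grouping by
  length bounds every finite partial sum by a geometric series with ratio
  \<open>CARD('x) * q\<close>.\<close>

lemma summable_on_power_length:
  fixes q :: real
  assumes "0 \<le> q" "real CARD('x) * q < 1"
  shows "(\<lambda>w::'x::finite list. q ^ length w) summable_on UNIV"
proof (rule nonneg_bdd_above_summable_on)
  let ?t = "real CARD('x) * q"
  show "bdd_above (sum (\<lambda>w::'x list. q ^ length w) ` {F. F \<subseteq> UNIV \<and> finite F})"
  proof (rule bdd_aboveI2)
    fix F :: "'x list set" assume "F \<in> {F. F \<subseteq> UNIV \<and> finite F}"
    then have F: "finite F" by simp
    \<comment> \<open>Inserting \<open>0\<close> keeps the maximum meaningful for empty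
      \<open>F\<close>.\<close>
    define l where "l = Max (insert 0 (length ` F))"
    have len: "length w \<le> l" if "w \<in> F" for w
      using that F by (auto simp: l_def)
    have fin: "finite {w::'x list. length w = k}" for k
      using finite_lists_length_eq[of "UNIV :: 'x set" k] by simp
    have card: "card {w::'x list. length w = k} = CARD('x) ^ k" for k
      using card_lists_length_eq[of "UNIV :: 'x set" k] by simp
    have "(\<Sum>w\<in>F. q ^ length w) \<le> (\<Sum>w\<in>(\<Union>k\<le>l. {w::'x list. length w = k}). q ^ length w)"
    proof (rule sum_mono2)
      show "finite (\<Union>k\<le>l. {w::'x list. length w = k})"
        using fin by blast
    qed (use len assms(1) in auto)
    also have "\<dots> = (\<Sum>k\<le>l. \<Sum>w\<in>{w::'x list. length w = k}. q ^ length w)"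
      using fin by (intro sum.UNION_disjoint) auto
    also have "\<dots> = (\<Sum>k\<le>l. ?t ^ k)"
      by (intro sum.cong) (auto simp: card power_mult_distrib)
    also have "\<dots> \<le> suminf ((^) ?t)"
      using assms by (intro sum_le_suminf summable_geometric) auto
    finally show "(\<Sum>w\<in>F. q ^ length w) \<le> suminf ((^) ?t)" .
  qed
qed (use assms in auto)

lemma summable_on_geometric_bound:
  fixes a :: "'x::finite list \<Rightarrow> real"
  assumes "\<And>w. \<bar>a w\<bar> \<le> C * q ^ length w" "0 \<le> q" "real CARD('x) * q < 1"
  shows "a summable_on UNIV"
proof (rule abs_summable_summable, rule abs_summable_on_comparison_test')
  show "(\<lambda>w::'x list. C * q ^ length w) summable_on UNIV"
    by (intro summable_on_cmult_right summable_on_power_length assms)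
qed (use assms in auto)

text \<open>Passing from \<open>N\<close> to \<open>Suc N\<close> adds one summand to the outermost
  sum: the increment on \<open>x # w\<close> is
  \<open>u (Suc N) x * iterated_sum w u (Suc N)\<close>. The nonempty words split into finitely many
  disjoint classes by first letter, so the increments can be summed class by class.\<close>

lemma infsum_iterated_sum_Suc:
  fixes a :: "'x::finite series"
  assumes N: "(\<lambda>w. a w * iterated_sum w u N) summable_on UNIV"
    and Suc: "\<And>x. (\<lambda>w. a (x # w) * iterated_sum w u (Suc N)) summable_on UNIV"
  shows "(\<Sum>\<^sub>\<infinity>w. a w * iterated_sum w u (Suc N)) =
    (\<Sum>\<^sub>\<infinity>w. a w * iterated_sum w u N) +
    (\<Sum>x\<in>UNIV. u (Suc N) x * (\<Sum>\<^sub>\<infinity>w. a (x # w) * iterated_sum w u (Suc N)))"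
proof -
  define d where "d w = a w * (iterated_sum w u (Suc N) - iterated_sum w u N)" for w
  let ?s = "\<lambda>x. u (Suc N) x * (\<Sum>\<^sub>\<infinity>w. a (x # w) * iterated_sum w u (Suc N))"
  have "(d has_sum ?s x) (range ((#) x))" for x
  proof -
    have "d \<circ> (#) x = (\<lambda>w. u (Suc N) x * (a (x # w) * iterated_sum w u (Suc N)))"
      by (auto simp: d_def)
    then show ?thesis
      using has_sum_cmult_right[OF has_sum_infsum[OF Suc[of x]], of "u (Suc N) x"]
      by (subst has_sum_reindex) auto
  qed
  then have "(d has_sum (\<Sum>x\<in>UNIV. ?s x)) (\<Union>x\<in>UNIV. range ((#) x))"
    by (intro sum_has_sum) auto
  \<comment> \<open>Only the empty word is left, and its iterated sum is \<open>1\<close> at both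
    times.\<close>
  moreover have "d w = 0" if "w \<notin> (\<Union>x\<in>UNIV. range ((#) x))" for w
    using that by (cases w) (auto simp: d_def)
  ultimately have "(d has_sum (\<Sum>x\<in>UNIV. ?s x)) UNIV"
    using has_sum_cong_neutral[of UNIV "\<Union>x\<in>UNIV. range ((#) x)" d d] by blast
  from has_sum_add[OF has_sum_infsum[OF N] this] show ?thesis
    by (intro infsumI) (simp add: d_def algebra_simps)
qed

section \<open>The realization\<close>

text \<open>The maximal absolute row sum is a submultiplicative norm; here the entries are bounded
  directly by peeling off the first letter.\<close>

lemma abs_mat_entry_le_power:
  fixes \<mu> :: "'x list \<Rightarrow> real mat"
  assumes carrier: "\<And>w. \<mu> w \<in> carrier_mat n n" and one: "\<mu> [] = 1\<^sub>m n"
    and append: "\<And>v w. \<mu> (v @ w) = \<mu> v * \<mu> w"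
    and row: "\<And>x i. i < n \<Longrightarrow> (\<Sum>j<n. \<bar>\<mu> [x] $$ (i, j)\<bar>) \<le> L"
    and "i < n" "j < n"
  shows "\<bar>\<mu> w $$ (i, j)\<bar> \<le> L ^ length w"
  using assms(5)
proof (induction w arbitrary: i)
  case Nil
  then show ?case using one assms(6) by simp
next
  case (Cons x w)
  have L: "0 \<le> L" using row[OF Cons.prems, of x] by (smt (verit) sum_nonneg abs_ge_zero)
  have "\<mu> (x # w) = \<mu> [x] * \<mu> w" using append[of "[x]" w] by simp
  then have "\<bar>\<mu> (x # w) $$ (i, j)\<bar> = \<bar>\<Sum>k<n. \<mu> [x] $$ (i, k) * \<mu> w $$ (k, j)\<bar>"
    using carrier[of "[x]"] carrier[of w] Cons.prems assms(6)
    by (simp add: scalar_prod_def lessThan_atLeast0)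
  also have "\<dots> \<le> (\<Sum>k<n. \<bar>\<mu> [x] $$ (i, k)\<bar> * L ^ length w)"
    by (rule order_trans[OF sum_abs]) (auto simp: abs_mult intro!: sum_mono mult_left_mono Cons.IH)
  also have "\<dots> = (\<Sum>k<n. \<bar>\<mu> [x] $$ (i, k)\<bar>) * L ^ length w" by (simp add: sum_distrib_right)
  also have "\<dots> \<le> L * L ^ length w"
    using row[OF Cons.prems] L by (intro mult_right_mono) auto
  finally show ?case by simp
qed

text \<open>Two smallness conditions serve different ends: \<open>R * L < 1\<close> makes the
  implicit one-step system solvable, and the bound involving \<open>CARD('x)\<close> and
  \<open>Nf\<close> makes the series converge absolutely.\<close>

lemma realization_of_linear_representation:
  fixes c :: "'x::finite series"
  assumes rep: "linear_representation n \<mu> \<gamma> \<Lambda> c"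
    and row: "\<And>i. i < n \<Longrightarrow> (\<Sum>x\<in>UNIV. \<Sum>j<n. \<bar>\<mu> [x] $$ (i, j)\<bar>) \<le> L"
    and R: "0 \<le> R" "R * L < 1" and L: "0 \<le> L"
    and small: "real CARD('x) * (L * (real Nf * R)) < 1"
    and U: "\<And>u N x. u \<in> U \<Longrightarrow> N \<le> Nf \<Longrightarrow> \<bar>u N x\<bar> \<le> R"
  shows "has_rational_input_state_affine_realization c Nf U"
proof -
  have carrier: "\<mu> w \<in> carrier_mat n n" and append: "\<mu> (v @ w) = \<mu> v * \<mu> w"
    and one: "\<mu> [] = 1\<^sub>m n" and \<gamma>: "\<gamma> \<in> carrier_mat n 1" and \<Lambda>: "\<Lambda> \<in> carrier_mat 1 n"
    and c: "c w = (\<Lambda> * \<mu> w * \<gamma>) $$ (0, 0)" for v w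
    using rep by (auto simp: linear_representation_def)
  have row': "(\<Sum>j<n. \<bar>\<mu> [x] $$ (i, j)\<bar>) \<le> L" if "i < n" for i x
    by (rule order_trans[OF _ row[OF that]])
      (rule member_le_sum[of x UNIV "\<lambda>x. \<Sum>j<n. \<bar>\<mu> [x] $$ (i, j)\<bar>"], auto intro: sum_nonneg)

  \<comment> \<open>Vector coefficients, state and system matrix\<close>
  define g where "g i w = (\<mu> w * \<gamma>) $$ (i, 0)" for i w
  define Z where "Z u N i = (\<Sum>\<^sub>\<infinity>w. g i w * iterated_sum w u N)" for u N i
  define C where "C = (\<Sum>j<n. \<bar>\<gamma> $$ (j, 0)\<bar>)"
  \<comment> \<open>This is \<open>I - (\<Sum>x. v x * \<mu> [x])\<close>, the matrix of the
    implicit equation that determines the next state.\<close>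
  define B where "B v = mat n n (\<lambda>(i, j). (if i = j then 1 else 0) - (\<Sum>x\<in>UNIV. v x * \<mu> [x] $$ (i, j)))"
    for v :: "'x \<Rightarrow> real"
  have B: "B v \<in> carrier_mat n n" for v
    by (simp add: B_def)

  have g_bound: "\<bar>g i w\<bar> \<le> C * L ^ length w" if "i < n" for i w
  proof -
    have "\<bar>g i w\<bar> = \<bar>\<Sum>j<n. \<mu> w $$ (i, j) * \<gamma> $$ (j, 0)\<bar>"
      using that carrier[of w] \<gamma> by (simp add: g_def scalar_prod_def lessThan_atLeast0)
    also have "\<dots> \<le> (\<Sum>j<n. L ^ length w * \<bar>\<gamma> $$ (j, 0)\<bar>)"
      by (rule order_trans[OF sum_abs])
        (auto simp: abs_mult that intro!: sum_mono mult_right_mono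
          abs_mat_entry_le_power[OF carrier one append row'])
    finally show ?thesis by (simp add: C_def sum_distrib_left sum_distrib_right mult.commute)
  qed
  have g_Cons: "g i (x # w) = (\<Sum>j<n. \<mu> [x] $$ (i, j) * g j w)" if "i < n" for i x w
  proof -
    have "\<mu> (x # w) * \<gamma> = \<mu> [x] * (\<mu> w * \<gamma>)"
      using append[of "[x]" w] carrier \<gamma> by (simp add: assoc_mult_mat[of _ n n _ n _ 1])
    moreover have "(\<mu> [x] * G) $$ (i, 0) = (\<Sum>j<n. \<mu> [x] $$ (i, j) * G $$ (j, 0))"
      if "G \<in> carrier_mat n 1" for G
      using that \<open>i < n\<close> carrier[of "[x]"] by (simp add: scalar_prod_def lessThan_atLeast0)
    ultimately show ?thesis
      using carrier[of w] \<gamma> unfolding g_def by (metis mult_carrier_mat)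
  qed
  have c_g: "c w = (\<Sum>i<n. \<Lambda> $$ (0, i) * g i w)" for w
  proof -
    have "\<Lambda> * \<mu> w * \<gamma> = \<Lambda> * (\<mu> w * \<gamma>)"
      using \<Lambda> carrier[of w] \<gamma> by (rule assoc_mult_mat)
    moreover have "(\<Lambda> * G) $$ (0, 0) = (\<Sum>j<n. \<Lambda> $$ (0, j) * G $$ (j, 0))"
      if "G \<in> carrier_mat n 1" for G
      using that \<Lambda> by (simp add: scalar_prod_def lessThan_atLeast0)
    ultimately show ?thesis
      using carrier[of w] \<gamma> unfolding g_def c by (metis mult_carrier_mat)
  qed

  \<comment> \<open>Convergence and the difference equation\<close>
  have summable: "(\<lambda>w. g i w * iterated_sum w u N) summable_on UNIV"
    if "u \<in> U" "N \<le> Nf" "i < n" for u N i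
  proof (rule summable_on_geometric_bound)
    fix w
    \<comment> \<open>The growth of the coefficients and that of the iterated sums combine to the
      ratio \<open>L * (real Nf * R)\<close>, to which \<open>small\<close> applies.\<close>
    have "\<bar>g i w * iterated_sum w u N\<bar> \<le> C * L ^ length w * (real Nf * R) ^ length w"
      unfolding abs_mult using that L
      by (intro mult_mono g_bound abs_iterated_sum_le U) (auto simp: C_def intro: sum_nonneg)
    then show "\<bar>g i w * iterated_sum w u N\<bar> \<le> C * (L * (real Nf * R)) ^ length w"
      by (simp add: power_mult_distrib)
  qed (use L R small in auto)
  \<comment> \<open>At time 0 the iterated sum of every nonempty word is an empty sum, so the
    initial state does not depend on the input.\<close>
  have Z_0: "Z u 0 i = g i []" for u i
  proof -
    have "Z u 0 i = (\<Sum>\<^sub>\<infinity>w\<in>{[]}. g i w * iterated_sum w u 0)"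
      unfolding Z_def
    proof (rule infsum_cong_neutral)
      show "g i w * iterated_sum w u 0 = 0" if "w \<in> UNIV - {[]}" for w
        using that by (cases w) auto
    qed auto
    then show ?thesis by simp
  qed
  have Z_Suc: "Z u (Suc N) i = Z u N i + (\<Sum>x\<in>UNIV. u (Suc N) x * (\<Sum>j<n. \<mu> [x] $$ (i, j) * Z u (Suc N) j))"
    if u: "u \<in> U" and N: "Suc N \<le> Nf" and i: "i < n" for u N i
  proof -
    \<comment> \<open>Stated with \<open>has_sum\<close> since both consequences are needed:
      summability along words beginning with \<open>x\<close>, and the value of that sum in terms of
      the state.\<close>
    have "((\<lambda>w. g i (x # w) * iterated_sum w u (Suc N)) has_sum
        (\<Sum>j<n. \<mu> [x] $$ (i, j) * Z u (Suc N) j)) UNIV" for x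
    proof -
      have "((\<lambda>w. \<Sum>j<n. \<mu> [x] $$ (i, j) * (g j w * iterated_sum w u (Suc N))) has_sum
          (\<Sum>j<n. \<mu> [x] $$ (i, j) * Z u (Suc N) j)) UNIV"
        unfolding Z_def
        by (intro has_sum_sum has_sum_cmult_right has_sum_infsum summable u N) simp
      then show ?thesis
        by (simp add: g_Cons[OF i] sum_distrib_right mult.assoc)
    qed
    note * = this
    show ?thesis
      using infsum_iterated_sum_Suc[OF summable[OF u Suc_leD[OF N] i] has_sum_imp_summable[OF *]]
      unfolding infsumI[OF *] Z_def[of u _ i] .
  qed

  \<comment> \<open>Unique solvability of the implicit system\<close>
  have det: "det (B v) \<noteq> 0" if v: "\<And>x. \<bar>v x\<bar> \<le> R" for v
    unfolding B_def
  proof (rule det_one_minus_nonzero)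
    fix i assume i: "i < n"
    have "(\<Sum>j<n. \<bar>\<Sum>x\<in>UNIV. v x * \<mu> [x] $$ (i, j)\<bar>) \<le> (\<Sum>j<n. \<Sum>x\<in>UNIV. R * \<bar>\<mu> [x] $$ (i, j)\<bar>)"
      by (intro sum_mono order_trans[OF sum_abs]) (auto simp: abs_mult intro!: mult_right_mono v)
    also have "\<dots> = R * (\<Sum>x\<in>UNIV. \<Sum>j<n. \<bar>\<mu> [x] $$ (i, j)\<bar>)"
      by (subst sum.swap) (simp add: sum_distrib_left)
    also have "\<dots> \<le> R * L" using R row[OF i] by (intro mult_left_mono) auto
    finally show "(\<Sum>j<n. \<bar>\<Sum>x\<in>UNIV. v x * \<mu> [x] $$ (i, j)\<bar>) < 1" using R by simp
  qed
  have B_Z: "B (u (Suc N)) *\<^sub>v vec n (Z u (Suc N)) = vec n (Z u N)"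
    if u: "u \<in> U" and N: "Suc N \<le> Nf" for u N
  proof (rule eq_vecI)
    fix i assume "i < dim_vec (vec n (Z u N))"
    then have i: "i < n" by simp
    let ?v = "u (Suc N)" and ?z = "Z u (Suc N)"
    have "(B ?v *\<^sub>v vec n ?z) $ i
        = (\<Sum>j<n. ((if i = j then 1 else 0) - (\<Sum>x\<in>UNIV. ?v x * \<mu> [x] $$ (i, j))) * ?z j)"
      using i by (simp add: B_def scalar_prod_def lessThan_atLeast0)
    also have "\<dots> = (\<Sum>j<n. if i = j then ?z j else 0) - (\<Sum>j<n. \<Sum>x\<in>UNIV. ?v x * \<mu> [x] $$ (i, j) * ?z j)"
      unfolding sum_subtractf[symmetric]
      by (rule sum.cong) (auto simp: left_diff_distrib sum_distrib_right)
    also have "\<dots> = ?z i - (\<Sum>x\<in>UNIV. ?v x * (\<Sum>j<n. \<mu> [x] $$ (i, j) * ?z j))"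
      using i by (subst sum.swap) (simp add: sum_distrib_left mult.assoc)
    also have "\<dots> = Z u N i" using Z_Suc[OF u N i] by simp
    finally show "(B ?v *\<^sub>v vec n ?z) $ i = vec n (Z u N) $ i" using i by simp
  qed (simp add: B_def)

  \<comment> \<open>Rational inverse by Cramer's rule\<close>
  have B_poly: "mpoly_function (\<lambda>v. B v $$ (i, j))" if "i < n" "j < n" for i j
  proof -
    have "mpoly_function (\<lambda>v. (if i = j then 1 else 0) - (\<Sum>x\<in>UNIV. v x * \<mu> [x] $$ (i, j)))"
      by (intro mpoly_function_diff mpoly_function_sum mpoly_function_mult
          mpoly_function_const mpoly_function_coordinate)
    then show ?thesis using that by (simp add: B_def)
  qed
  \<comment> \<open>The determinant \<open>q\<close> is the common denominator of all transition
    coefficients; the adjugate entries \<open>p i j\<close> are the numerators.\<close>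
  obtain q where q: "\<And>v. mpoly_eval q v = det (B v)"
    using mpoly_function_det[OF B B_poly] unfolding mpoly_function_def by blast
  have "\<exists>p. \<forall>v. mpoly_eval p v = adj_mat (B v) $$ (i, j)" if "i < n" "j < n" for i j
    using mpoly_function_adj_mat[OF B B_poly that] unfolding mpoly_function_def by blast
  then obtain p where p: "\<And>i j v. i < n \<Longrightarrow> j < n \<Longrightarrow> mpoly_eval (p i j) v = adj_mat (B v) $$ (i, j)"
    by metis
  \<comment> \<open>The zero input lies within the bound \<open>R\<close>, so \<open>q\<close> has a
    nonvanishing value there and is not the zero polynomial.\<close>
  have q_nonzero: "q \<noteq> 0"
    using q[of "\<lambda>x. 0"] det[of "\<lambda>x. 0"] R by auto
  \<comment> \<open>Needed for the affine terms, which are represented by the fraction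
    \<open>0 / 1\<close>.\<close>
  have mpoly_eval_1: "mpoly_eval 1 v = 1" for v :: "'x \<Rightarrow> real"
    using mpoly_eval_single[of 0 1 v] by simp

  \<comment> \<open>State trajectory, output and realization\<close>
  let ?r = "\<lambda>i j. (p i j, q)" and ?s = "\<lambda>i. (0, 1) :: 'x ratfun"
    and ?z0 = "vec n (\<lambda>i. g i [])"
  define h where "h v = (\<Sum>i<n. \<Lambda> $$ (0, i) * v $ i)" for v :: "real vec"
  have state: "state n ?r ?s ?z0 u N = vec n (Z u N)" if u: "u \<in> U" and "N \<le> Nf" for u N
    using that(2)
  proof (induction N)
    case 0
    show ?case by (auto simp: Z_0)
  next
    case (Suc N)
    let ?v = "u (Suc N)"
    have "det (B ?v) \<noteq> 0"
      using U[OF u] Suc.prems by (intro det) auto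
    moreover have "(\<Sum>j<n. adj_mat (B ?v) $$ (i, j) * Z u N j) = det (B ?v) * Z u (Suc N) i"
      if i: "i < n" for i
    proof -
      have "(\<Sum>j<n. adj_mat (B ?v) $$ (i, j) * Z u N j) = (adj_mat (B ?v) *\<^sub>v vec n (Z u N)) $ i"
        using i adj_mat(1)[OF B[of ?v]] by (simp add: scalar_prod_def lessThan_atLeast0)
      \<comment> \<open>Substituting \<open>B_Z\<close> for the old state produces the product of
        the adjugate with \<open>B ?v\<close>, which is the determinant times the identity.\<close>
      also have "adj_mat (B ?v) *\<^sub>v vec n (Z u N) = (adj_mat (B ?v) * B ?v) *\<^sub>v vec n (Z u (Suc N))"
        using assoc_mult_mat_vec[OF adj_mat(1)[OF B] B, of "vec n (Z u (Suc N))" ?v]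
          B_Z[OF u Suc.prems] by simp
      also have "\<dots> = det (B ?v) \<cdot>\<^sub>v vec n (Z u (Suc N))"
        unfolding adj_mat(3)[OF B] by (rule eq_vecI) simp_all
      also have "\<dots> $ i = det (B ?v) * Z u (Suc N) i"
        using i by simp
      finally show ?thesis .
    qed
    ultimately have "(\<Sum>j<n. adj_mat (B ?v) $$ (i, j) / det (B ?v) * Z u N j) = Z u (Suc N) i"
      if "i < n" for i
      using that by (simp add: sum_divide_distrib[symmetric] field_simps)
    then show ?case
      using Suc by (auto simp: ratfun_eval_def p q mpoly_eval_1 intro!: eq_vecI)
  qed
  have fliess: "((\<lambda>w. c w * iterated_sum w u N) has_sum h (vec n (Z u N))) UNIV"
    if "u \<in> U" "N \<le> Nf" for u N
  proof -
    have "((\<lambda>w. \<Sum>i<n. \<Lambda> $$ (0, i) * (g i w * iterated_sum w u N)) has_sum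
        (\<Sum>i<n. \<Lambda> $$ (0, i) * Z u N i)) UNIV"
      unfolding Z_def
      by (intro has_sum_sum has_sum_cmult_right has_sum_infsum summable that) simp
    then show ?thesis
      by (simp add: c_g h_def sum_distrib_right mult.assoc)
  qed
  have "linear_output n h"
    unfolding linear_output_def h_def
    by (auto simp: algebra_simps sum.distrib sum_distrib_left intro!: sum.cong)
  moreover have "recursion_well_defined n ?r ?s Nf u" if "u \<in> U" for u
    using U[OF that] det
    by (auto simp: recursion_well_defined_def ratfun_defined_at_def q mpoly_eval_1)
  moreover have "fliess_converges c u N \<and> fliess c u N = h (state n ?r ?s ?z0 u N)"
    if "u \<in> U" "N \<le> Nf" for u N
    using fliess[OF that] state[OF that]
    by (auto simp: fliess_converges_def fliess_def infsumI has_sum_imp_summable)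
  moreover have "\<forall>i<n. (\<forall>j<n. is_ratfun (?r i j)) \<and> is_ratfun (?s i)"
    using q_nonzero by (simp add: is_ratfun_def)
  ultimately show ?thesis
    unfolding has_rational_input_state_affine_realization_def
    by (intro exI[of _ n] exI[of _ ?r] exI[of _ ?s] exI[of _ h] exI[of _ ?z0]) auto
qed

theorem theorem8:
  fixes x0 :: "'x::finite"
    and c :: "'x series"
    and n :: nat
    and \<mu> :: "'x list \<Rightarrow> real mat"
    and \<gamma> \<Lambda> :: "real mat"
    and Nf :: nat
  assumes "rational_series c"
    and "linear_representation n \<mu> \<gamma> \<Lambda> c"
    and "Nf > 0"
  shows "\<exists>R0>0. \<forall>R. 0 < R \<and> R \<le> R0 \<longrightarrow>
           has_rational_input_state_affine_realization c Nf (admissible_inputs x0 Nf R)"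
proof -
  \<comment> \<open>The sum over all rows dominates each single row; the added \<open>1\<close>
    keeps \<open>L\<close> positive even if all letter matrices vanish.\<close>
  define L where "L = 1 + (\<Sum>i<n. \<Sum>x\<in>UNIV. \<Sum>j<n. \<bar>\<mu> [x] $$ (i, j)\<bar>)"
  have L: "1 \<le> L"
    unfolding L_def by (simp add: sum_nonneg)
  have row: "(\<Sum>x\<in>UNIV. \<Sum>j<n. \<bar>\<mu> [x] $$ (i, j)\<bar>) \<le> L" if "i < n" for i
    using that member_le_sum[of i "{..<n}" "\<lambda>i. \<Sum>x\<in>UNIV. \<Sum>j<n. \<bar>\<mu> [x] $$ (i, j)\<bar>"]
    by (simp add: L_def sum_nonneg)
  \<comment> \<open>Since the alphabet is nonempty and \<open>Nf > 0\<close>, \<open>D\<close> also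
    dominates \<open>L\<close>, so the single inequality \<open>R * D < 1\<close> yields both
    smallness conditions.\<close>
  define D where "D = real CARD('x) * L * real Nf"
  have "1 * L * 1 \<le> D"
    unfolding D_def using L assms(3) by (intro mult_mono) (auto simp: Suc_le_eq)
  then have D: "L \<le> D" "0 < D" using L by auto
  show ?thesis
  \<comment> \<open>The factor 2 gives \<open>R * D \<le> 1 / 2\<close>, hence strict inequality
    even at the largest radius allowed.\<close>
  proof (intro exI[of _ "1 / (2 * D)"] conjI allI impI)
    show "0 < 1 / (2 * D)" using D by simp
    fix R assume R: "0 < R \<and> R \<le> 1 / (2 * D)"
    then have RD: "R * D < 1"
      using D by (simp add: field_simps)
    show "has_rational_input_state_affine_realization c Nf (admissible_inputs x0 Nf R)"
    proof (rule realization_of_linear_representation[OF assms(2) row])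
      have "R * L \<le> R * D" using R D by (intro mult_left_mono) auto
      then show "R * L < 1" using RD by linarith
      show "real CARD('x) * (L * (real Nf * R)) < 1"
        using RD by (simp add: D_def mult_ac)
    qed (use R L in \<open>auto simp: admissible_inputs_def\<close>)
  qed
qed

end
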